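(* For all integers $n\ge 0$ and $m>1$, $sp(n,m)=oc(n,m)$.
   Context: Fix $m>1$. Semi-$m$-Pell compositions: $SP(n,m)=\{(n)\}$ for $1\le n\le m$; if $n>m$ and $m\mid n$, $SP(n,m)$ consists of the compositions in $SP(n/m,m)$ with every part multiplied by $m$; if $n>m$ and $n\equiv r\pmod m$, $1\le r\le m-1$, $SP(n,m)$ consists of the compositions obtained by inserting a part $r$ at the beginning or end of each composition in $SP(n-r,m)$, together with those obtained from each composition in $SP(n-m,m)$ by adding $m$ to its (unique) part congruent to $r$ mod $m$. Let $sp(n,m)=|SP(n,m)|$ for $n\ge1$ and $sp(0,m)=1$; equivalently $sp(0,m)=1$, $sp(n,m)=1$ for $1\le n\le m-1$, and for $n\ge m$: $sp(n,m)=sp(n/m,m)$ if $m\mid n$, and $sp(n,m)=2sp(n-r,m)+sp(n-m,m)$ if $n\equiv r\pmod m$, $0<r<m$. $oc(n,m)$ is the number of weakly unimodal compositions of $n$ into powers of $m$ in which every part size that occurs appears in a single block of consecutive positions with multiplicity not divisible by $m$ ($oc(0,m)=1$). A composition is weakly unimodal if it has the form $(a_1,\dots,a_r,c,b_s,\dots,b_1)$ with $a_1\le\cdots\le a_r\le c>b_s\ge\cdots\ge b_1\ge1$ (the $a$'s or $b$'s may be absent). *)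

theory Defs
  imports Main
begin

text \<open>
  Compositions are lists of positive naturals. \<open>SP n m\<close> is the set of semi-\<open>m\<close>-Pell compositions
  of \<open>n\<close>, meaningful for \<open>n \<ge> 1\<close> and \<open>m > 1\<close>; the first branch is only there to make the recursion
  well-founded. The part congruent to \<open>n mod m\<close> in the last set is unique, so each \<open>xs\<close>
  contributes exactly one list there.
\<close>

function SP :: "nat \<Rightarrow> nat \<Rightarrow> nat list set" where
  "SP n m =
    (if n = 0 \<or> m \<le> 1 then {}
     else if n \<le> m then {[n]}
     else if m dvd n then map (\<lambda>x. m * x) ` SP (n div m) m
     else (\<lambda>xs. (n mod m) # xs) ` SP (n - n mod m) m
        \<union> (\<lambda>xs. xs @ [n mod m]) ` SP (n - n mod m) m
        \<union> {xs[i := xs ! i + m] | xs i.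
             xs \<in> SP (n - m) m \<and> i < length xs \<and> xs ! i mod m = n mod m})"
  by pat_completeness auto
termination
  by (relation "Wellfounded.measure fst") (auto simp: dvd_eq_mod_eq_0)

declare SP.simps [simp del]

definition sp :: "nat \<Rightarrow> nat \<Rightarrow> nat" where
  "sp n m = (if n = 0 then 1 else card (SP n m))"

definition composition :: "nat \<Rightarrow> nat list \<Rightarrow> bool" where
  "composition n xs \<longleftrightarrow> (\<forall>x\<in>set xs. x \<ge> 1) \<and> sum_list xs = n"

definition weakly_unimodal :: "nat list \<Rightarrow> bool" where
  "weakly_unimodal xs \<longleftrightarrow>
    (\<exists>as c bs. xs = as @ [c] @ bs \<and> sorted_wrt (\<le>) (as @ [c]) \<and>
       sorted_wrt (\<ge>) bs \<and> (\<forall>b\<in>set bs. c > b))"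

definition single_block :: "'a \<Rightarrow> 'a list \<Rightarrow> bool" where
  "single_block x xs \<longleftrightarrow>
    (\<exists>us k vs. xs = us @ replicate k x @ vs \<and> x \<notin> set us \<and> x \<notin> set vs)"

definition OC :: "nat \<Rightarrow> nat \<Rightarrow> nat list set" where
  "OC n m = {xs. composition n xs \<and> weakly_unimodal xs \<and>
     (\<forall>x\<in>set xs. (\<exists>k. x = m ^ k) \<and> single_block x xs \<and> \<not> m dvd count_list xs x)}"

text \<open>A weakly unimodal composition has a largest part \<open>c\<close>, so \<open>n = 0\<close> is a separate convention.\<close>

definition oc :: "nat \<Rightarrow> nat \<Rightarrow> nat" where
  "oc n m = (if n = 0 then 1 else card (OC n m))"

end

theory Submission
  imports Defs
begin

text \<open>
  Both counts satisfy the same recursion in \<open>n\<close>. If \<open>m\<close> divides \<open>n\<close>, then the number of parts \<open>1\<close>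
  of a composition counted by \<open>oc\<close> is divisible by \<open>m\<close>, hence zero, and all parts can be divided by
  \<open>m\<close>. If \<open>n \<equiv> r\<close> modulo \<open>m\<close> with \<open>0 < r < m\<close>, then the ones form a block at one end whose length
  is congruent to \<open>r\<close>: either it has length \<open>r\<close> and can be removed (two choices of the end), or
  \<open>m\<close> of the ones can be removed.
\<close>

section \<open>Semi-Pell compositions\<close>

text \<open>Nonemptiness needs an induction; divisibility is read off one unfolding, where the list
  is \<open>[m]\<close> or has all its parts multiplied by \<open>m\<close>.\<close>

lemma SP_parts_dvd:
  assumes "m > 1" "m dvd n" "xs \<in> SP n m"
  shows "xs \<noteq> [] \<and> (\<forall>x\<in>set xs. m dvd x)"
proof -
  have ne: "ys \<noteq> []" if "ys \<in> SP k m" for k ys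
    using that
  proof (induction k m arbitrary: ys rule: SP.induct)
    case (1 n m)
    \<comment> \<open>Only multiplication by \<open>m\<close> could pass emptiness on: insertions
      are nonempty, and an update presupposes a valid index.\<close>
    from "1.prems" "1.IH"(1)[of "[]"] show ?case
      by (subst (asm) (1) SP.simps) (auto split: if_splits dest!: arg_cong[of "[]" _ length])
  qed
  from assms show ?thesis
    using ne[OF assms(3)] by (subst (asm) (1) SP.simps) (auto split: if_splits dest: dvd_imp_le)
qed

section \<open>The unique part not divisible by \<open>m\<close>\<close>

text \<open>Mapped over a list with exactly one part not divisible by \<open>m\<close>, this
  performs the update in \<open>SP\<close>. It refers to no index, so the third set of the recursion
  becomes an image.\<close>

definition raise_nondivisible :: "nat \<Rightarrow> nat \<Rightarrow> nat" where
  "raise_nondivisible m x = (if m dvd x then x else x + m)"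

lemma map_raise_nondivisible_id:
  "\<forall>x\<in>set xs. m dvd x \<Longrightarrow> map (raise_nondivisible m) xs = xs"
  by (induction xs) (auto simp: raise_nondivisible_def)

lemma inj_raise_nondivisible: "inj (raise_nondivisible m)"
  by (auto simp: inj_def raise_nondivisible_def split: if_splits)

text \<open>Raised values are multiples of \<open>m\<close> or at least \<open>m\<close>, while
  \<open>n mod m\<close> lies strictly between 0 and \<open>m\<close>. This separates raised lists
  from those with an inserted part.\<close>

lemma raise_nondivisible_neq_mod:
  "m > 0 \<Longrightarrow> \<not> m dvd n \<Longrightarrow> raise_nondivisible m x \<noteq> n mod m"
  by (auto simp: raise_nondivisible_def dvd_eq_mod_eq_0)
     (metis less_not_refl mod_less_divisor not_add_less2)

text \<open>For \<open>r > 0\<close> exactly one position holds a part not divisible by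
  \<open>m\<close>; the decomposition locates it at \<open>length us\<close>.\<close>

definition one_residue :: "nat \<Rightarrow> nat \<Rightarrow> nat list \<Rightarrow> bool" where
  "one_residue m r xs \<longleftrightarrow> (\<exists>us x vs. xs = us @ x # vs \<and> x mod m = r \<and>
     (\<forall>u\<in>set us. m dvd u) \<and> (\<forall>v\<in>set vs. m dvd v))"

lemma one_residue_raise:
  assumes "one_residue m r xs" "0 < r"
  shows "{xs[i := xs ! i + m] | i. i < length xs \<and> xs ! i mod m = r}
    = {map (raise_nondivisible m) xs}"
    and "one_residue m r (map (raise_nondivisible m) xs)"
proof -
  obtain us x vs where xs: "xs = us @ x # vs" "x mod m = r"
    and d: "\<forall>u\<in>set us. m dvd u" "\<forall>v\<in>set vs. m dvd v"
    using assms unfolding one_residue_def by blast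
  have "\<not> m dvd x" using xs assms by (auto simp: dvd_eq_mod_eq_0)
  then have map: "map (raise_nondivisible m) xs = us @ (x + m) # vs"
    using d by (simp add: xs map_raise_nondivisible_id raise_nondivisible_def)
  then show "one_residue m r (map (raise_nondivisible m) xs)"
    unfolding one_residue_def using xs d by (metis mod_add_self2)
  \<comment> \<open>Any other index points into \<open>us\<close> or \<open>vs\<close>, where the
    residue is 0 and not \<open>r\<close>.\<close>
  have iff: "i = length us" if "i < length xs" "xs ! i mod m = r" for i
  proof (rule ccontr)
    assume "i \<noteq> length us"
    then have "xs ! i \<in> set us \<union> set vs"
      using that xs by (auto simp: nth_append nth_Cons split: nat.splits)
    then have "m dvd xs ! i" using d by blast
    then show False using that assms by (auto simp: dvd_eq_mod_eq_0)
  qed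
  have len: "length us < length xs" and nth: "xs ! length us mod m = r"
    by (simp_all add: xs)
  have "{i. i < length xs \<and> xs ! i mod m = r} = {length us}"
    using iff len nth by blast
  then have "{xs[i := xs ! i + m] | i. i < length xs \<and> xs ! i mod m = r}
      = (\<lambda>i. xs[i := xs ! i + m]) ` {length us}"
    by blast
  then show "{xs[i := xs ! i + m] | i. i < length xs \<and> xs ! i mod m = r}
    = {map (raise_nondivisible m) xs}"
    unfolding map by (simp add: xs)
qed

text \<open>Inserting \<open>n mod m\<close> into a list of multiples of \<open>m\<close> creates
  its only nondivisible part, and adding \<open>m\<close> to that part keeps its residue.\<close>

lemma SP_one_residue:
  assumes "m > 1" "\<not> m dvd n" "xs \<in> SP n m"
  shows "one_residue m (n mod m) xs"
  using assms(2,3)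
proof (induction n arbitrary: xs rule: less_induct)
  case (less n)
  let ?r = "n mod m"
  have r: "0 < ?r" "?r < m" using less.prems assms by (auto simp: dvd_eq_mod_eq_0)
  show ?case
  proof (cases "n \<le> m")
    case True
    then have "xs = [] @ n # []"
      using less.prems assms by (subst (asm) SP.simps) (auto split: if_splits)
    then show ?thesis unfolding one_residue_def by fastforce
  next
    case False
    have "m dvd n - ?r" by (simp add: minus_mod_eq_mult_div)
    then have d: "\<forall>y\<in>set ys. m dvd y" if "ys \<in> SP (n - ?r) m" for ys
      using SP_parts_dvd assms that by blast
    have mod: "(n - m) mod m = ?r" using False by (simp add: le_mod_geq)
    have IH: "one_residue m ?r ys" if "ys \<in> SP (n - m) m" for ys
      using less.IH[of "n - m" ys] that False assms mod r by (auto simp: dvd_eq_mod_eq_0)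
    from less.prems consider
      ys where "xs = [] @ ?r # ys" "ys \<in> SP (n - ?r) m"
      | ys where "xs = ys @ ?r # []" "ys \<in> SP (n - ?r) m"
      | ys i where "xs = ys[i := ys ! i + m]" "ys \<in> SP (n - m) m" "i < length ys" "ys ! i mod m = ?r"
      using False by (subst (asm) SP.simps) (auto split: if_splits)
    then show ?thesis
    proof cases
      case (1 ys)
      with d[OF 1(2)] show ?thesis unfolding one_residue_def
        by (intro exI[of _ "[]"] exI[of _ ?r] exI[of _ ys] conjI) simp_all
    next
      case (2 ys)
      with d[OF 2(2)] show ?thesis unfolding one_residue_def
        by (intro exI[of _ ys] exI[of _ ?r] exI[of _ "[]"] conjI) simp_all
    next
      case (3 ys i)
      then have "xs \<in> {ys[i := ys ! i + m] | i. i < length ys \<and> ys ! i mod m = ?r}" by blast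
      then show ?thesis
        using one_residue_raise[OF IH[OF 3(2)] r(1)] by simp
    qed
  qed
qed

text \<open>Since the nondivisible part is unique, each list of \<open>SP (n - m) m\<close> admits
  exactly one update, namely the raised list.\<close>

lemma SP_nondivisible:
  assumes "m > 1" "\<not> m dvd n" "n > m"
  shows "SP n m = Cons (n mod m) ` SP (n - n mod m) m
    \<union> (\<lambda>xs. xs @ [n mod m]) ` SP (n - n mod m) m
    \<union> map (raise_nondivisible m) ` SP (n - m) m"
proof -
  let ?r = "n mod m"
  have r: "0 < ?r" using assms by (auto simp: dvd_eq_mod_eq_0)
  have mod: "(n - m) mod m = ?r" using assms by (simp add: le_mod_geq)
  then have res: "one_residue m ?r xs" if "xs \<in> SP (n - m) m" for xs
    using SP_one_residue[OF assms(1) _ that] r by (auto simp: dvd_eq_mod_eq_0)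
  have "{xs[i := xs ! i + m] | xs i. xs \<in> SP (n - m) m \<and> i < length xs \<and> xs ! i mod m = ?r}
    = (\<Union>xs\<in>SP (n - m) m. {xs[i := xs ! i + m] | i. i < length xs \<and> xs ! i mod m = ?r})"
    by blast
  also have "\<dots> = (\<Union>xs\<in>SP (n - m) m. {map (raise_nondivisible m) xs})"
    using one_residue_raise(1)[OF res r] by (intro SUP_cong) auto
  finally show ?thesis
    using assms by (subst SP.simps) auto
qed

section \<open>Cardinalities of the semi-Pell sets\<close>

lemma finite_SP: "finite (SP n m)"
proof (induction n m rule: SP.induct)
  case (1 n m)
  consider "n \<le> m \<or> m \<le> 1 \<or> m dvd n" | "m > 1" "\<not> m dvd n" "n > m" by linarith
  then show ?case
  proof cases
    case 1
    then show ?thesis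
      using "1.IH" by (subst SP.simps) auto
  next
    case 2
    then show ?thesis
      using "1.IH" by (subst SP_nondivisible) auto
  qed
qed

text \<open>The three images are disjoint: lists in \<open>?A\<close> begin with \<open>?r\<close>,
  those in \<open>?B\<close> with a multiple of \<open>m\<close>, and lists in \<open>?C\<close> do
  not contain \<open>?r\<close>. All three maps are injective.\<close>

lemma card_SP_nondivisible:
  assumes "m > 1" "\<not> m dvd n" "n > m"
  shows "card (SP n m) = 2 * card (SP (n - n mod m) m) + card (SP (n - m) m)"
proof -
  let ?r = "n mod m"
  let ?A = "Cons ?r ` SP (n - ?r) m" and ?B = "(\<lambda>xs. xs @ [?r]) ` SP (n - ?r) m"
  let ?C = "map (raise_nondivisible m) ` SP (n - m) m"
  have "m dvd n - ?r" by (simp add: minus_mod_eq_mult_div)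
  then have d: "ys \<noteq> [] \<and> (\<forall>y\<in>set ys. m dvd y)" if "ys \<in> SP (n - ?r) m" for ys
    using SP_parts_dvd assms that by blast
  have r: "\<not> m dvd ?r" using assms by (simp add: dvd_mod_iff)
  have "?A \<inter> ?B = {}"
  proof -
    have False if "xs \<in> ?A" "xs \<in> ?B" for xs
    proof -
      obtain ys zs where *: "zs \<in> SP (n - ?r) m" "?r # ys = zs @ [?r]"
        using \<open>xs \<in> ?A\<close> \<open>xs \<in> ?B\<close> by blast
      have "hd zs = ?r" using *(2) d[OF *(1)] by (metis hd_append2 list.sel(1))
      then show False using d[OF *(1)] r hd_in_set by metis
    qed
    then show ?thesis by blast
  qed
  moreover have "(?A \<union> ?B) \<inter> ?C = {}"
  proof -
    have "?r \<in> set xs" if "xs \<in> ?A \<union> ?B" for xs using that by auto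
    moreover have "?r \<notin> set xs" if "xs \<in> ?C" for xs
    proof -
      have "set xs \<subseteq> range (raise_nondivisible m)" using that by auto
      moreover have "?r \<notin> range (raise_nondivisible m)"
        using raise_nondivisible_neq_mod[of m n] assms by fastforce
      ultimately show ?thesis by blast
    qed
    ultimately show ?thesis by (meson disjoint_iff)
  qed
  moreover have "card ?A = card (SP (n - ?r) m)" "card ?B = card (SP (n - ?r) m)"
    "card ?C = card (SP (n - m) m)"
    using inj_raise_nondivisible[of m] by (auto intro!: card_image simp: inj_on_def inj_mapI
        dest: injD[OF inj_mapI])
  ultimately show ?thesis
    using SP_nondivisible[OF assms] by (simp add: card_Un_disjoint finite_SP)
qed

lemma card_SP_mult:
  assumes "m > 1" "n > 0"
  shows "card (SP (m * n) m) = card (SP n m)"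
proof (cases "n = 1")
  \<comment> \<open>Here \<open>m * n = m\<close> belongs to the initial branch of
    \<open>SP\<close>, not to the multiplication branch; both sets are singletons.\<close>
  case True
  then show ?thesis using assms by (subst (1 2) SP.simps) simp
next
  case False
  have "inj (map ((*) m))" using assms by (intro inj_mapI) (auto simp: inj_def)
  then have "card (map ((*) m) ` SP n m) = card (SP n m)"
    by (intro card_image) (auto simp: inj_on_def inj_def)
  then show ?thesis using assms False by (subst SP.simps) simp
qed

section \<open>Unimodal lists and blocks\<close>

lemma weakly_unimodal_not_Nil: "weakly_unimodal xs \<Longrightarrow> xs \<noteq> []"
  by (auto simp: weakly_unimodal_def)

text \<open>As the least possible part, 1 can always extend the rising side at its start.\<close>

lemma weakly_unimodal_Cons_1:
  assumes "\<forall>x\<in>set xs. x \<ge> 1" "xs \<noteq> []"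
  shows "weakly_unimodal (1 # xs) \<longleftrightarrow> weakly_unimodal xs"
proof
  assume "weakly_unimodal (1 # xs)"
  then obtain as c bs where *: "1 # xs = as @ [c] @ bs" "sorted_wrt (\<le>) (as @ [c])"
    "sorted_wrt (\<ge>) bs" "\<forall>b\<in>set bs. c > b"
    unfolding weakly_unimodal_def by blast
  \<comment> \<open>An empty \<open>as\<close> would make 1 the peak, and the nonempty rest would
    need parts below 1.\<close>
  then obtain a as' where "as = a # as'"
    using assms by (cases as; cases bs) auto
  with * show "weakly_unimodal xs"
    unfolding weakly_unimodal_def
    by (intro exI[of _ as'] exI[of _ c] exI[of _ bs]) auto
next
  assume "weakly_unimodal xs"
  then obtain as c bs where *: "xs = as @ [c] @ bs" "sorted_wrt (\<le>) (as @ [c])"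
    "sorted_wrt (\<ge>) bs" "\<forall>b\<in>set bs. c > b"
    unfolding weakly_unimodal_def by blast
  then show "weakly_unimodal (1 # xs)"
    unfolding weakly_unimodal_def using assms
    by (intro exI[of _ "1 # as"] exI[of _ c] exI[of _ bs]) auto
qed

lemma weakly_unimodal_snoc_1:
  assumes "\<forall>x\<in>set xs. x \<ge> 1" "xs \<noteq> []"
  shows "weakly_unimodal (xs @ [1]) \<longleftrightarrow> weakly_unimodal xs"
proof
  assume "weakly_unimodal (xs @ [1])"
  then obtain as c bs where *: "xs @ [1] = as @ [c] @ bs" "sorted_wrt (\<le>) (as @ [c])"
    "sorted_wrt (\<ge>) bs" "\<forall>b\<in>set bs. c > b"
    unfolding weakly_unimodal_def by blast
  show "weakly_unimodal xs"
  proof (cases bs rule: rev_cases)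
    \<comment> \<open>The removed 1 is the peak of a rising list, so the last entry of
      \<open>xs\<close> becomes the new peak.\<close>
    case Nil
    with * assms obtain as' c' where "xs = as' @ [c']" by (metis rev_exhaust)
    with * Nil have "xs = as' @ [c'] @ []" "sorted_wrt (\<le>) (as' @ [c'])"
      by (auto simp: sorted_wrt_append)
    then show ?thesis
      unfolding weakly_unimodal_def
      by (intro exI[of _ as'] exI[of _ c'] exI[of _ "[]"]) simp
  next
    case (snoc bs' b)
    with * show ?thesis
      unfolding weakly_unimodal_def
      by (intro exI[of _ as] exI[of _ c] exI[of _ bs']) (auto simp: sorted_wrt_append)
  qed
next
  assume "weakly_unimodal xs"
  then obtain as c bs where *: "xs = as @ [c] @ bs" "sorted_wrt (\<le>) (as @ [c])"
    "sorted_wrt (\<ge>) bs" "\<forall>b\<in>set bs. c > b"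
    unfolding weakly_unimodal_def by blast
  show "weakly_unimodal (xs @ [1])"
  proof (cases "c = 1")
    \<comment> \<open>The falling side must stay strictly below the peak, so a 1 after the peak 1
      cannot join it; it becomes the new peak instead.\<close>
    case True
    with * assms have "bs = []" by (cases bs) auto
    with * True show ?thesis
      unfolding weakly_unimodal_def
      by (intro exI[of _ "as @ [c]"] exI[of _ 1] exI[of _ "[]"]) (auto simp: sorted_wrt_append)
  next
    case False
    with * assms show ?thesis
      unfolding weakly_unimodal_def
      by (intro exI[of _ as] exI[of _ c] exI[of _ "bs @ [1]"]) (auto simp: sorted_wrt_append)
  qed
qed

lemma weakly_unimodal_replicate_1_append:
  assumes "\<forall>x\<in>set xs. x \<ge> 1" "xs \<noteq> []"
  shows "weakly_unimodal (replicate k 1 @ xs) \<longleftrightarrow> weakly_unimodal xs"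
proof (induction k)
  case (Suc k)
  then show ?case
    using weakly_unimodal_Cons_1[of "replicate k 1 @ xs"] assms by (simp add: ball_Un)
qed simp

lemma weakly_unimodal_append_replicate_1:
  assumes "\<forall>x\<in>set xs. x \<ge> 1" "xs \<noteq> []"
  shows "weakly_unimodal (xs @ replicate k 1) \<longleftrightarrow> weakly_unimodal xs"
proof (induction k)
  case (Suc k)
  have "xs @ replicate (Suc k) 1 = (xs @ replicate k 1) @ [1]"
    by (simp add: replicate_append_same)
  then show ?case
    using weakly_unimodal_snoc_1[of "xs @ replicate k 1"] assms Suc by (simp add: ball_Un)
qed simp

lemma weakly_unimodal_replicate: "k > 0 \<Longrightarrow> weakly_unimodal (replicate k x)"
  unfolding weakly_unimodal_def
  by (intro exI[of _ "replicate (k - 1) x"] exI[of _ x] exI[of _ "[]"])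
     (auto simp: sorted_wrt_append replicate_append_same simp flip: replicate_Suc
       intro: sorted_replicate)

text \<open>If \<open>y\<close> is on the rising side or is the peak, it bounds everything before
  it; if it is on the falling side, it bounds everything after it.\<close>

lemma weakly_unimodal_valley:
  assumes "weakly_unimodal (us @ y # vs)" "u \<in> set us" "v \<in> set vs"
  shows "u \<le> y \<or> v \<le> y"
proof -
  obtain as c bs where "us @ y # vs = as @ c # bs"
    and s: "sorted_wrt (\<le>) (as @ [c])" "sorted_wrt (\<ge>) bs" "\<forall>b\<in>set bs. c > b"
    using assms unfolding weakly_unimodal_def by auto
  then consider ws where "as @ [c] = us @ y # ws" | ws where "bs = ws @ y # vs"
    by (auto simp: append_eq_append_conv2 Cons_eq_append_conv append_eq_Cons_conv)
  then show ?thesis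
    using s assms(2,3) by cases (auto simp: sorted_wrt_append)
qed

lemma weakly_unimodal_map_strict_mono:
  fixes f :: "nat \<Rightarrow> nat"
  assumes "strict_mono f"
  shows "weakly_unimodal (map f xs) \<longleftrightarrow> weakly_unimodal xs"
proof
  assume "weakly_unimodal (map f xs)"
  then obtain as c bs where "map f xs = as @ [c] @ bs" "sorted_wrt (\<le>) (as @ [c])"
    "sorted_wrt (\<ge>) bs" "\<forall>b\<in>set bs. c > b"
    unfolding weakly_unimodal_def by blast
  moreover then obtain as' c' bs' where "xs = as' @ [c'] @ bs'"
    "as = map f as'" "c = f c'" "bs = map f bs'"
    by (auto simp: map_eq_append_conv map_eq_Cons_conv)
  ultimately show "weakly_unimodal xs"
    unfolding weakly_unimodal_def
    by (intro exI[of _ as'] exI[of _ c'] exI[of _ bs'])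
       (auto simp: sorted_wrt_append sorted_wrt_map strict_mono_less_eq[OF assms]
         strict_mono_less[OF assms])
next
  assume "weakly_unimodal xs"
  then obtain as c bs where "xs = as @ [c] @ bs" "sorted_wrt (\<le>) (as @ [c])"
    "sorted_wrt (\<ge>) bs" "\<forall>b\<in>set bs. c > b"
    unfolding weakly_unimodal_def by blast
  then show "weakly_unimodal (map f xs)"
    unfolding weakly_unimodal_def
    by (intro exI[of _ "map f as"] exI[of _ "f c"] exI[of _ "map f bs"])
       (auto simp: sorted_wrt_append sorted_wrt_map strict_mono_less_eq[OF assms]
         strict_mono_less[OF assms])
qed

section \<open>Blocks of equal entries\<close>

lemma single_block_map_inj:
  assumes "inj f"
  shows "single_block (f x) (map f xs) \<longleftrightarrow> single_block x xs"
proof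
  assume "single_block (f x) (map f xs)"
  then obtain us k vs where "map f xs = us @ replicate k (f x) @ vs" "f x \<notin> set us" "f x \<notin> set vs"
    unfolding single_block_def by blast
  moreover from this(1) obtain us' ws vs' where
    "xs = us' @ ws @ vs'" "us = map f us'" "map f ws = replicate k (f x)" "vs = map f vs'"
    by (metis map_eq_append_conv)
  moreover have "ws = replicate k x"
    using calculation(6) assms by (metis inj_map_eq_map map_replicate)
  ultimately have "xs = us' @ replicate k x @ vs'" "x \<notin> set us'" "x \<notin> set vs'" by auto
  then show "single_block x xs"
    unfolding single_block_def by blast
next
  assume "single_block x xs"
  then obtain us k vs where "xs = us @ replicate k x @ vs" "x \<notin> set us" "x \<notin> set vs"
    unfolding single_block_def by blast
  then show "single_block (f x) (map f xs)"
    unfolding single_block_def using assms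
    by (intro exI[of _ "map f us"] exI[of _ k] exI[of _ "map f vs"]) (auto dest: injD)
qed

lemma single_block_Cons_neq:
  assumes "y \<noteq> x"
  shows "single_block x (y # xs) \<longleftrightarrow> single_block x xs"
proof
  assume "single_block x (y # xs)"
  then obtain us k vs where *: "y # xs = us @ replicate k x @ vs" "x \<notin> set us" "x \<notin> set vs"
    unfolding single_block_def by blast
  show "single_block x xs"
  proof (cases us)
    \<comment> \<open>Since \<open>y\<close> differs from \<open>x\<close>, the block has length 0;
      so \<open>x\<close> is absent, which also counts as a block of length 0.\<close>
    case Nil
    with * assms have "x \<notin> set xs" by (cases k) auto
    then show ?thesis unfolding single_block_def
      by (intro exI[of _ xs] exI[of _ 0] exI[of _ "[]"]) auto
  next
    case (Cons u us')
    with * show ?thesis unfolding single_block_def by auto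
  qed
next
  assume "single_block x xs"
  then obtain us k vs where "xs = us @ replicate k x @ vs" "x \<notin> set us" "x \<notin> set vs"
    unfolding single_block_def by blast
  then show "single_block x (y # xs)" unfolding single_block_def
    using assms by (intro exI[of _ "y # us"] exI[of _ k] exI[of _ vs]) auto
qed

text \<open>Reversal carries the result on prepended entries over to appended ones.\<close>

lemma single_block_rev: "single_block x (rev xs) \<longleftrightarrow> single_block x xs"
proof -
  have "single_block x (rev xs)" if "single_block x xs" for xs :: "'a list"
  proof -
    obtain us k vs where "xs = us @ replicate k x @ vs" "x \<notin> set us" "x \<notin> set vs"
      using \<open>single_block x xs\<close> unfolding single_block_def by blast
    then show ?thesis unfolding single_block_def
      by (intro exI[of _ "rev vs"] exI[of _ k] exI[of _ "rev us"]) auto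
  qed
  from this[of xs] this[of "rev xs"] show ?thesis by auto
qed

lemma single_block_replicate_append_neq:
  "y \<noteq> x \<Longrightarrow> single_block x (replicate k y @ xs) \<longleftrightarrow> single_block x xs"
  by (induction k) (auto simp: single_block_Cons_neq)

lemma single_block_append_replicate_neq:
  "y \<noteq> x \<Longrightarrow> single_block x (xs @ replicate k y) \<longleftrightarrow> single_block x xs"
  using single_block_replicate_append_neq[of y x k "rev xs"]
    single_block_rev[of x "xs @ replicate k y"]
  by (simp add: single_block_rev)

lemma count_list_replicate: "count_list (replicate k x) y = (if x = y then k else 0)"
  by (induction k) auto

text \<open>Powers with positive exponent vanish modulo \<open>m\<close>, so only the ones
  contribute.\<close>

lemma sum_list_mod_powers:
  fixes m :: nat
  assumes "m > 1" "\<forall>x\<in>set xs. \<exists>k. x = m ^ k"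
  shows "sum_list xs mod m = count_list xs 1 mod m"
  using assms(2)
proof (induction xs)
  case (Cons x xs)
  then obtain k where k: "x = m ^ k" by auto
  have IH: "sum_list xs mod m = count_list xs 1 mod m" using Cons by simp
  show ?case
  proof (cases k)
    case 0
    with k IH show ?thesis
      using mod_Suc_eq[of "sum_list xs" m] mod_Suc_eq[of "count_list xs 1" m] by simp
  next
    case (Suc j)
    moreover have "x \<noteq> 1" using k Suc assms(1) by simp
    ultimately show ?thesis using k IH by simp
  qed
qed simp

section \<open>Block compositions into powers\<close>

lemma mem_OC_iff:
  assumes "m > 1"
  shows "xs \<in> OC n m \<longleftrightarrow> sum_list xs = n \<and> weakly_unimodal xs \<and>
     (\<forall>x\<in>set xs. (\<exists>k. x = m ^ k) \<and> single_block x xs \<and> \<not> m dvd count_list xs x)"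
  using assms by (auto simp: OC_def composition_def)

lemma OC_parts_ge_1: "xs \<in> OC n m \<Longrightarrow> x \<in> set xs \<Longrightarrow> x \<ge> 1"
  by (auto simp: OC_def composition_def)

lemma OC_parts_power: "xs \<in> OC n m \<Longrightarrow> x \<in> set xs \<Longrightarrow> \<exists>k. x = m ^ k"
  by (simp add: OC_def)

lemma OC_mod:
  assumes "m > 1" "xs \<in> OC n m"
  shows "count_list xs 1 mod m = n mod m"
  using sum_list_mod_powers[OF assms(1), of xs] assms by (auto simp: mem_OC_iff)

text \<open>The multiplicity of 1 is congruent to \<open>n\<close> modulo \<open>m\<close>; it is 0
  if 1 is absent and not a multiple of \<open>m\<close> otherwise.\<close>

lemma OC_1_mem_iff:
  assumes "m > 1" "xs \<in> OC n m"
  shows "1 \<in> set xs \<longleftrightarrow> \<not> m dvd n"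
proof -
  have "1 \<in> set xs \<longleftrightarrow> \<not> m dvd count_list xs 1"
    using assms by (metis mem_OC_iff count_list_0_iff dvd_0_right)
  then show ?thesis using OC_mod[OF assms] by (metis dvd_eq_mod_eq_0)
qed

text \<open>Ones at an end affect neither unimodality nor the blocks and multiplicities of other
  parts. As an equivalence, this lets one admissible number of ones be exchanged for
  another.\<close>

lemma replicate_1_append_mem_OC_iff:
  assumes "m > 1" "1 \<notin> set ys" "ys \<noteq> []" "\<not> m dvd k"
  shows "replicate k 1 @ ys \<in> OC n m \<longleftrightarrow> k \<le> n \<and> ys \<in> OC (n - k) m" (is "?P \<longleftrightarrow> ?Q")
    and "ys @ replicate k 1 \<in> OC n m \<longleftrightarrow> k \<le> n \<and> ys \<in> OC (n - k) m" (is "?R \<longleftrightarrow> ?Q")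
proof -
  have k: "k > 0" using assms by (cases k) auto
  have ge: "\<forall>x\<in>set ys. x \<ge> 1" if "?P \<or> ?Q \<or> ?R"
    using that OC_parts_ge_1 by fastforce
  have pow: "\<exists>k. 1 = m ^ k" "\<exists>k. Suc 0 = m ^ k" by (auto intro: exI[of _ 0])
  have bl: "single_block 1 (replicate k 1 @ ys)" "single_block 1 (ys @ replicate k 1)"
    unfolding single_block_def using assms
    by (intro exI[of _ "[]"] exI[of _ k] exI[of _ ys], simp,
        intro exI[of _ ys] exI[of _ k] exI[of _ "[]"], simp)
  have cnt: "count_list ys 1 = 0" using assms by (simp add: count_list_0_iff)
  have neq: "1 \<noteq> x" if "x \<in> set ys" for x using that assms by auto
  have core: "(\<forall>x\<in>set (replicate k 1 @ ys). (\<exists>j. x = m ^ j) \<and> single_block x (replicate k 1 @ ys)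
        \<and> \<not> m dvd count_list (replicate k 1 @ ys) x) \<longleftrightarrow>
      (\<forall>x\<in>set ys. (\<exists>j. x = m ^ j) \<and> single_block x ys \<and> \<not> m dvd count_list ys x)"
    "(\<forall>x\<in>set (ys @ replicate k 1). (\<exists>j. x = m ^ j) \<and> single_block x (ys @ replicate k 1)
        \<and> \<not> m dvd count_list (ys @ replicate k 1) x) \<longleftrightarrow>
      (\<forall>x\<in>set ys. (\<exists>j. x = m ^ j) \<and> single_block x ys \<and> \<not> m dvd count_list ys x)"
    using k pow bl cnt neq assms(4)
    by (auto simp: ball_Un count_list_replicate single_block_replicate_append_neq
        single_block_append_replicate_neq cong: ball_cong_simp)
  show "?P \<longleftrightarrow> ?Q"
    using ge core(1) weakly_unimodal_replicate_1_append[of ys k] assms(3)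
    unfolding mem_OC_iff[OF assms(1)] by (auto simp: sum_list_replicate)
  show "?R \<longleftrightarrow> ?Q"
    using ge core(2) weakly_unimodal_append_replicate_1[of ys k] assms(3)
    unfolding mem_OC_iff[OF assms(1)] by (auto simp: sum_list_replicate)
qed

lemma replicate_1_mem_OC:
  assumes "m > 1" "\<not> m dvd k"
  shows "replicate k 1 \<in> OC k m"
proof -
  have k: "k > 0" using assms by (cases k) auto
  have "single_block 1 (replicate k (1::nat))"
    unfolding single_block_def by (intro exI[of _ "[]"] exI[of _ k] exI[of _ "[]"]) simp
  then show ?thesis
    using assms k weakly_unimodal_replicate[OF k, of 1]
    by (auto simp: mem_OC_iff sum_list_replicate count_list_replicate intro: exI[of _ 0])
qed

text \<open>The ones form a block, and parts on both sides of it would exceed 1, making a valley. So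
  the block is at an end, with length congruent to \<open>n\<close>.\<close>

lemma OC_ones_cases:
  assumes "m > 1" "\<not> m dvd n" "xs \<in> OC n m"
  obtains (all) "xs = replicate n 1"
  | (left) k ys where "xs = replicate k 1 @ ys" "k mod m = n mod m" "1 \<notin> set ys" "ys \<noteq> []"
  | (right) k ys where "xs = ys @ replicate k 1" "k mod m = n mod m" "1 \<notin> set ys" "ys \<noteq> []"
proof -
  have 1: "1 \<in> set xs" using OC_1_mem_iff assms by blast
  then have "single_block 1 xs" using assms by (simp add: mem_OC_iff)
  then obtain us k vs where xs: "xs = us @ replicate k 1 @ vs" and n: "1 \<notin> set us" "1 \<notin> set vs"
    unfolding single_block_def by blast
  have k: "k mod m = n mod m"
    using OC_mod[OF assms(1,3)] n by (simp add: xs count_list_replicate)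
  have "us = [] \<or> vs = []"
  proof (rule ccontr)
    assume ne: "\<not> ?thesis"
    obtain j where "k = Suc j" using 1 n xs by (cases k) auto
    \<comment> \<open>The first 1 of the block serves as the bottom of the valley; the other ones
      are put on its right.\<close>
    then have "weakly_unimodal (us @ 1 # (replicate j 1 @ vs))"
      using assms xs by (simp add: mem_OC_iff)
    then have "hd us \<le> 1 \<or> hd vs \<le> 1"
      using ne by (intro weakly_unimodal_valley) auto
    moreover have "hd us \<ge> 1" "hd vs \<ge> 1"
      using OC_parts_ge_1[OF assms(3)] xs ne by auto
    ultimately have "1 = hd us \<or> 1 = hd vs" by auto
    then show False using n ne hd_in_set by metis
  qed
  moreover have "k = n" if "us = []" "vs = []"
    using that assms xs by (simp add: mem_OC_iff sum_list_replicate)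
  ultimately show ?thesis
    using that xs k n by (cases "us = []"; cases "vs = []") auto
qed

section \<open>Multiplication of all parts by \<open>m\<close>\<close>

lemma OC_mult:
  assumes "m > 1"
  shows "OC (m * n) m = map ((*) m) ` OC n m"
proof -
  have sm: "strict_mono ((*) m)" using assms by (auto simp: strict_mono_def)
  have inj: "inj ((*) m)" using assms by (auto simp: inj_def)
  \<comment> \<open>The power condition is kept as a premise: in both uses below every entry of
    \<open>ys\<close> is a power of \<open>m\<close>, so both of its sides are true.\<close>
  have iff: "map ((*) m) ys \<in> OC (m * n) m \<longleftrightarrow> ys \<in> OC n m"
    if "\<forall>y\<in>set ys. (\<exists>k. m * y = m ^ k) \<longleftrightarrow> (\<exists>k. y = m ^ k)" for ys
  proof -
    have "sum_list (map ((*) m) ys) = m * sum_list ys" by (simp add: sum_list_const_mult)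
    moreover have "count_list (map ((*) m) ys) (m * y) = count_list ys y" for y
      using assms by (induction ys) auto
    ultimately show ?thesis
      using that assms weakly_unimodal_map_strict_mono[OF sm] single_block_map_inj[OF inj]
      by (auto simp: mem_OC_iff)
  qed
  show ?thesis
  proof (intro equalityI subsetI)
    fix xs assume xs: "xs \<in> OC (m * n) m"
    have pow: "\<exists>k. x = m * m ^ k" if "x \<in> set xs" for x
    proof -
      obtain k where "x = m ^ k" using OC_parts_power[OF xs \<open>x \<in> set xs\<close>] by blast
      \<comment> \<open>No part is 1, since \<open>m\<close> divides the total; hence each exponent
        is positive and a factor \<open>m\<close> splits off.\<close>
      moreover have "x \<noteq> 1" using OC_1_mem_iff[OF assms xs] that by auto
      ultimately show ?thesis by (cases k) auto
    qed
    let ?ys = "map (\<lambda>x. x div m) xs"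
    have eq: "map ((*) m) ?ys = xs"
      using pow by (auto intro!: map_idI dest!: pow)
    have "\<exists>k. y = m ^ k" if "y \<in> set ?ys" for y
      using that pow assms by fastforce
    then have "?ys \<in> OC n m"
      using iff[of ?ys] xs unfolding eq by (metis power_Suc)
    then show "xs \<in> map ((*) m) ` OC n m" using eq by (metis imageI)
  next
    fix xs assume "xs \<in> map ((*) m) ` OC n m"
    then obtain ys where ys: "xs = map ((*) m) ys" "ys \<in> OC n m" by blast
    then have "\<forall>y\<in>set ys. \<exists>k. y = m ^ k" using assms by (simp add: mem_OC_iff)
    then show "xs \<in> OC (m * n) m" using iff[of ys] ys by (metis power_Suc)
  qed
qed

lemma card_OC_mult:
  assumes "m > 1"
  shows "card (OC (m * n) m) = card (OC n m)"
proof -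
  have "inj (map ((*) m))" using assms by (intro inj_mapI) (auto simp: inj_def)
  then show ?thesis
    unfolding OC_mult[OF assms] by (intro card_image) (auto simp: inj_on_def inj_def)
qed

lemma finite_OC: "finite (OC n m)"
proof -
  have "length xs \<le> sum_list xs" if "\<forall>x\<in>set xs. x \<ge> 1" for xs :: "nat list"
    using that by (induction xs) auto
  then have "OC n m \<subseteq> {xs. set xs \<subseteq> {..n} \<and> length xs \<le> n}"
    by (auto simp: OC_def composition_def member_le_sum_list)
  then show ?thesis
    using finite_lists_length_le[of "{..n}" n] by (auto intro: finite_subset)
qed

text \<open>A part \<open>m ^ k\<close> is at most \<open>n\<close>, hence below \<open>m\<close>,
  which forces \<open>k = 0\<close>.\<close>

lemma OC_less:
  assumes "m > 1" "0 < n" "n < m"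
  shows "OC n m = {replicate n 1}"
proof -
  have nd: "\<not> m dvd n" using assms by (auto dest: dvd_imp_le)
  have "xs = replicate n 1" if "xs \<in> OC n m" for xs
  proof (rule ccontr)
    assume neq: "xs \<noteq> replicate n 1"
    have sum: "sum_list xs = n" using that assms by (simp add: mem_OC_iff)
    have "\<forall>x\<in>set xs. x = 1"
    proof
      fix x assume x: "x \<in> set xs"
      then obtain k where k: "x = m ^ k" using OC_parts_power[OF \<open>xs \<in> OC n m\<close> x] by blast
      have "m ^ k < m ^ 1" using member_le_sum_list[OF x] sum k assms by simp
      then have "k = 0" using assms(1) power_less_imp_less_exp by blast
      then show "x = 1" using k by simp
    qed
    then have xs1: "replicate (length xs) 1 = xs" by (simp add: replicate_length_same)
    have "sum_list (replicate (length xs) (1::nat)) = length xs" by (simp add: sum_list_replicate)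
    then have "length xs = n" using sum unfolding xs1 by simp
    then show False using neq xs1 by simp
  qed
  then show ?thesis using replicate_1_mem_OC[OF assms(1) nd] by blast
qed

section \<open>Removing or adding ones when \<open>m\<close> does not divide
  \<open>n\<close>\<close>

text \<open>Lengthens the block of ones where it stands: at the front if the list starts with 1,
  else at the end. Lists consisting of ones only are thus treated once.\<close>

definition add_ones :: "nat \<Rightarrow> nat list \<Rightarrow> nat list" where
  "add_ones m xs = (if hd xs = 1 then replicate m 1 @ xs else xs @ replicate m 1)"

lemma count_add_ones: "count_list (add_ones m xs) 1 = count_list xs 1 + m"
  by (simp add: add_ones_def count_list_replicate)

text \<open>For a nonempty list, the result starts with 1 exactly if the list did, so the result
  reveals which branch was taken.\<close>

lemma inj_on_add_ones:
  assumes "m > 0"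
  shows "inj_on (add_ones m) {xs. xs \<noteq> []}"
proof (rule inj_onI)
  fix xs ys :: "nat list"
  assume *: "xs \<in> {xs. xs \<noteq> []}" "ys \<in> {xs. xs \<noteq> []}" "add_ones m xs = add_ones m ys"
  have "hd (add_ones m zs) = 1 \<longleftrightarrow> hd zs = 1" if "zs \<noteq> []" for zs
    using that assms by (cases m) (auto simp: add_ones_def)
  then have "hd xs = 1 \<longleftrightarrow> hd ys = 1" using * by (metis mem_Collect_eq)
  then show "xs = ys" using *(3) by (auto simp: add_ones_def split: if_splits)
qed

text \<open>The block of ones has length congruent to \<open>n mod m\<close>. Below \<open>m\<close>
  this is \<open>n mod m\<close> itself, and the block is stripped from its end; otherwise removing
  \<open>m\<close> ones leaves a nonempty block.\<close>

lemma OC_nondivisible: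
  assumes "m > 1" "\<not> m dvd n" "n > m"
  shows "OC n m = (\<lambda>ys. replicate (n mod m) 1 @ ys) ` OC (n - n mod m) m
    \<union> (\<lambda>ys. ys @ replicate (n mod m) 1) ` OC (n - n mod m) m
    \<union> add_ones m ` OC (n - m) m" (is "_ = ?A \<union> ?B \<union> ?C")
proof -
  let ?r = "n mod m"
  have r: "\<not> m dvd ?r" "?r < m" "?r \<le> n" using assms by (auto simp: dvd_mod_iff)
  have nd: "\<not> m dvd n - m" using assms by (simp add: dvd_minus_self)
  have dv: "m dvd n - ?r" by (simp add: minus_mod_eq_mult_div)
  have mod: "(n - m) mod m = ?r" using assms by (simp add: le_mod_geq)
  have kd: "\<not> m dvd k" if "k mod m = ?r" for k
    using that assms by (simp add: dvd_eq_mod_eq_0)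
  note iffs = replicate_1_append_mem_OC_iff[OF assms(1)]
  have hd1: "hd ys \<noteq> 1" if "1 \<notin> set ys" "ys \<noteq> []" for ys :: "nat list"
    using that hd_in_set by metis
  show ?thesis
  proof (intro equalityI subsetI)
    fix xs assume xs: "xs \<in> OC n m"
    from assms(1,2) xs show "xs \<in> ?A \<union> ?B \<union> ?C"
    proof (cases rule: OC_ones_cases)
      case all
      have "hd (replicate (n - m) (1::nat)) = 1" using assms by (cases "n - m") auto
      then have "xs = add_ones m (replicate (n - m) 1)"
        using assms all by (simp add: add_ones_def flip: replicate_add)
      then show ?thesis using replicate_1_mem_OC[OF assms(1) nd] by blast
    next
      case (left k ys)
      show ?thesis
      proof (cases "k < m")
        case True
        then have "k = ?r" using left by simp
        then show ?thesis using left xs iffs(1)[OF left(3,4) r(1)] by auto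
      next
        case False
        then have m: "(k - m) mod m = ?r" using left by (simp add: le_mod_geq)
        \<comment> \<open>A 1 must remain in front, so that \<open>add_ones\<close> takes its first
          branch.\<close>
        have "k - m \<noteq> 0" using kd[OF m] by (metis dvd_0_right)
        then have "hd (replicate (k - m) 1 @ ys) = 1" by (cases "k - m") auto
        then have "xs = add_ones m (replicate (k - m) 1 @ ys)"
          using False left by (simp add: add_ones_def flip: append_assoc replicate_add)
        \<comment> \<open>Membership passes through \<open>ys\<close>: all \<open>k\<close> ones are
          stripped and \<open>k - m\<close> put back, with the sum \<open>n - k\<close> of
          \<open>ys\<close> unchanged.\<close>
        moreover have "replicate (k - m) 1 @ ys \<in> OC (n - m) m"
          using xs left False assms(3) iffs(1)[OF left(3,4) kd[OF m], of "n - m"]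
            iffs(1)[OF left(3,4) kd[OF left(2)], of n] by auto
        ultimately show ?thesis by blast
      qed
    next
      case (right k ys)
      show ?thesis
      proof (cases "k < m")
        case True
        then have "k = ?r" using right by simp
        then show ?thesis using right xs iffs(2)[OF right(3,4) r(1)] by auto
      next
        case False
        then have m: "(k - m) mod m = ?r" using right by (simp add: le_mod_geq)
        have "hd (ys @ replicate (k - m) 1) \<noteq> 1" using hd1[OF right(3,4)] right(4) by simp
        then have "xs = add_ones m (ys @ replicate (k - m) 1)"
          using False right by (simp add: add_ones_def flip: replicate_add)
        moreover have "ys @ replicate (k - m) 1 \<in> OC (n - m) m"
          using xs right False assms(3) iffs(2)[OF right(3,4) kd[OF m], of "n - m"]
            iffs(2)[OF right(3,4) kd[OF right(2)], of n] by auto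
        ultimately show ?thesis by blast
      qed
    qed
  next
    fix xs assume "xs \<in> ?A \<union> ?B \<union> ?C"
    then consider
      ys where "ys \<in> OC (n - ?r) m" "xs = replicate ?r 1 @ ys \<or> xs = ys @ replicate ?r 1"
      | zs where "zs \<in> OC (n - m) m" "xs = add_ones m zs" by blast
    then show "xs \<in> OC n m"
    proof cases
      case (1 ys)
      \<comment> \<open>The sum of \<open>ys\<close> is a multiple of \<open>m\<close>, so
        \<open>ys\<close> has no ones and the added block stands alone.\<close>
      have "1 \<notin> set ys" "ys \<noteq> []"
        using OC_1_mem_iff[OF assms(1) 1(1)] dv 1(1) assms(1)
        by (auto simp: mem_OC_iff dest: weakly_unimodal_not_Nil)
      then show ?thesis using iffs[of ys ?r n] 1 r by auto
    next
      case (2 zs)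
      from assms(1) nd 2(1) show ?thesis
      proof (cases rule: OC_ones_cases)
        case all
        have "hd (replicate (n - m) (1::nat)) = 1" using assms by (cases "n - m") auto
        then have "xs = replicate n 1"
          using assms all 2 by (simp add: add_ones_def flip: replicate_add)
        then show ?thesis using replicate_1_mem_OC assms by blast
      next
        case (left k ys)
        have k: "k mod m = ?r" "(m + k) mod m = ?r" using left mod by auto
        have "k \<noteq> 0" using kd[OF k(1)] by (metis dvd_0_right)
        then have "hd zs = 1" using left by (cases k) auto
        then have "xs = replicate (m + k) 1 @ ys"
          using 2 left by (simp add: add_ones_def replicate_add)
        then show ?thesis
          using 2 left assms(3) iffs(1)[OF left(3,4) kd[OF k(1)], of "n - m"]
            iffs(1)[OF left(3,4) kd[OF k(2)], of n] by (auto simp: add.commute)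
      next
        case (right k ys)
        have k: "k mod m = ?r" "(k + m) mod m = ?r" using right mod by auto
        have "hd zs \<noteq> 1" using hd1[OF right(3,4)] right by simp
        then have "xs = ys @ replicate (k + m) 1"
          using 2 right by (simp add: add_ones_def replicate_add)
        then show ?thesis
          using 2 right assms(3) iffs(2)[OF right(3,4) kd[OF k(1)], of "n - m"]
            iffs(2)[OF right(3,4) kd[OF k(2)], of n] by (auto simp: add.commute)
      qed
    qed
  qed
qed

text \<open>Lists in \<open>?A\<close> start with 1 and those in \<open>?B\<close> do not; both have
  exactly \<open>?r < m\<close> ones, whereas lists in \<open>?C\<close> have at least
  \<open>m\<close>.\<close>

lemma card_OC_nondivisible:
  assumes "m > 1" "\<not> m dvd n" "n > m"
  shows "card (OC n m) = 2 * card (OC (n - n mod m) m) + card (OC (n - m) m)"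
proof -
  let ?r = "n mod m"
  let ?A = "(\<lambda>ys. replicate ?r 1 @ ys) ` OC (n - ?r) m"
  let ?B = "(\<lambda>ys. ys @ replicate ?r 1) ` OC (n - ?r) m"
  let ?C = "add_ones m ` OC (n - m) m"
  have r: "0 < ?r" "?r < m" using assms by (auto simp: dvd_eq_mod_eq_0)
  have dv: "m dvd n - ?r" by (simp add: minus_mod_eq_mult_div)
  have no1: "1 \<notin> set ys" "ys \<noteq> []" if "ys \<in> OC (n - ?r) m" for ys
    using OC_1_mem_iff[OF assms(1) that] dv that assms(1)
    by (auto simp: mem_OC_iff dest: weakly_unimodal_not_Nil)
  have "?A \<inter> ?B = {}"
  proof -
    have False if "xs \<in> ?A" "xs \<in> ?B" for xs
    proof -
      obtain ys zs where *: "zs \<in> OC (n - ?r) m"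
        "replicate ?r 1 @ ys = zs @ replicate ?r 1"
        using \<open>xs \<in> ?A\<close> \<open>xs \<in> ?B\<close> by blast
      have "hd (replicate ?r 1 @ ys) = 1" using r by (cases ?r) auto
      then have "hd zs = 1" using * no1 by simp
      then show False using no1[OF *(1)] hd_in_set by metis
    qed
    then show ?thesis by blast
  qed
  moreover have "(?A \<union> ?B) \<inter> ?C = {}"
  proof -
    have "count_list xs 1 = ?r" if "xs \<in> ?A \<union> ?B" for xs
      using that no1 by (auto simp: count_list_replicate)
    moreover have "count_list xs 1 \<ge> m" if "xs \<in> ?C" for xs
      using that count_add_ones by auto
    ultimately show ?thesis using r by fastforce
  qed
  moreover have "card ?A = card (OC (n - ?r) m)" "card ?B = card (OC (n - ?r) m)"
    by (auto intro!: card_image simp: inj_on_def)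
  moreover have "card ?C = card (OC (n - m) m)"
  proof (rule card_image)
    have "OC (n - m) m \<subseteq> {xs. xs \<noteq> []}"
      using assms(1) by (auto simp: mem_OC_iff dest: weakly_unimodal_not_Nil)
    then show "inj_on (add_ones m) (OC (n - m) m)"
      using inj_on_add_ones[of m] assms(1) by (auto intro: inj_on_subset)
  qed
  ultimately show ?thesis
    using OC_nondivisible[OF assms] by (simp add: card_Un_disjoint finite_OC)
qed

section \<open>Comparison of the two recursions\<close>

lemma card_SP_eq_card_OC:
  assumes "m > 1" "n > 0"
  shows "card (SP n m) = card (OC n m)"
  using assms(2)
proof (induction n rule: less_induct)
  case (less n)
  \<comment> \<open>The value \<open>n = m\<close> belongs to the second case, with
    \<open>q = 1\<close>.\<close>
  consider "n < m" | q where "n = m * q" "q > 0" | "\<not> m dvd n" "n > m"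
    using less.prems by (metis dvd_def linorder_neqE_nat dvd_refl mult_0_right neq0_conv)
  then show ?case
  proof cases
    case 1
    then show ?thesis
      using OC_less[OF assms(1) less.prems] less.prems by (subst SP.simps) simp
  next
    case (2 q)
    then have "q < n" using assms by simp
    then show ?thesis
      using 2 less.IH[of q] assms by (simp add: card_SP_mult card_OC_mult)
  next
    case 3
    \<comment> \<open>The first bound makes \<open>n - n mod m\<close> smaller than
      \<open>n\<close>, the second keeps it positive, as the induction hypothesis requires.\<close>
    then have "0 < n mod m" "n mod m < n"
      using assms by (auto simp: dvd_eq_mod_eq_0 intro: less_trans[of _ m])
    then show ?thesis
      using 3 less.IH[of "n - n mod m"] less.IH[of "n - m"] assms
      by (simp add: card_SP_nondivisible card_OC_nondivisible)
  qed
qed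

text \<open>For \<open>n = 0\<close> both counts are 1 by convention; positive \<open>n\<close> is
  the induction above.\<close>

theorem theorem2p2:
  fixes n m :: nat
  assumes "m > 1"
  shows "sp n m = oc n m"
  using card_SP_eq_card_OC[OF assms] by (simp add: sp_def oc_def)

end
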